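(* Let $A_1=A_2=[0,1]$ and consider a single-controller two-player zero-sum polynomial stochastic game with the problems $(P')$ and $(SP)$ defined in the context. Then the semidefinite program $(SP)$ exactly solves the polynomial optimization problem $(P')$: a pair $(\mathbf{v},(\bar\nu(s))_{s\in\mathcal{S}})$ is feasible for $(P')$ if and only if there exist symmetric matrices $Z_s,W_s$ ($s\in\mathcal{S}$) such that $(\mathbf{v},(\bar\nu(s))_s,(Z_s,W_s)_s)$ is feasible for $(SP)$; in particular, the two problems (having the same objective $\sum_s v(s)$) have the same optimal value and the same optimal $(\mathbf{v},(\bar\nu(s))_s)$.
   Context: Game data. $\mathcal{S}=\{1,\dots,S\}$; $0\le\beta<1$; for each $s$, $r(s,a_1,a_2)=\sum_{i=0}^{d_s}\sum_{j=0}^{m_s}r_{ij}(s)a_1^ia_2^j$ is a real polynomial; the transition probabilities $p(s';s,a_1)$ are real polynomials in $a_1$ of degree at most $d_s$, nonnegative on $[0,1]$ and summing to 1 over $s'$. The degree bounds $d_s,m_s$ are taken to be positive even integers (pad with zero coefficients). Moments and nonnegativity. $\mathcal{P}([0,1])$: univariate real polynomials nonnegative on $[0,1]$. $\mathcal{M}([0,1])\subset\mathbb{R}^{n+1}$: vectors of first $n+1$ moments $(\int 1\,d\lambda,\dots,\int x^n d\lambda)$ of nonnegative measures $\lambda$ supported on $[0,1]$. $\bar\nu(s)=(\nu_0(s),\dots,\nu_{m_s}(s))^T\in\mathbb{R}^{m_s+1}$. Problem $(P')$: minimize $\sum_{s}v(s)$ over $\mathbf{v}\in\mathbb{R}^S$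 and $\bar\nu(s)$, $s\in\mathcal{S}$, subject to, for all $s$: the polynomial in $a_1$ given by $v(s)-\sum_{i,j}r_{ij}(s)a_1^i\nu_j(s)-\beta\sum_{s'}p(s';s,a_1)v(s')$ lies in $\mathcal{P}([0,1])$; $\bar\nu(s)\in\mathcal{M}([0,1])$; $\nu_0(s)=1$. Operators. $\mathcal{H}:\mathbb{R}^{2k-1}\to\{k\times k\text{ symmetric matrices}\}$ maps $(a_1,\dots,a_{2k-1})$ to the Hankel matrix with $(i,j)$ entry $a_{i+j-1}$. Its adjoint $\mathcal{H}^*$ maps a symmetric $k\times k$ matrix $M$ to the vector in $\mathbb{R}^{2k-1}$ whose $l$-th entry is $\sum_{i+j=l+1}M_{ij}$ (sum along antidiagonals). $L_1=\begin{bmatrix} I_{n\times n} \\ 0_{1\times n} \end{bmatrix}$ and $L_2=\begin{bmatrix} 0_{1\times n} \\ I_{n\times n} \end{bmatrix}$, with $n=d_s/2$ in the constraints on $Z_s,W_s$ and $n=m_s/2$ in those on $\mathcal{H}(\bar\nu(s))$. $R(s)\in\mathbb{R}^{(d_s+1)\times(m_s+1)}$ has entries $r_{ij}(s)$ (indices from 0). $Q(s)\in\mathbb{R}^{(d_s+1)\times S}$ has as column $s'$ the coefficient vector (constant term first) of $p(s';s,a_1)$. $E_s\in\mathbb{R}^{(d_s+1)\times S}$ has a 1 in position $(1,s)$ and zeros elsewhere. $e_1$ is the first standard basis vector; $\succeq0$ means positive semidefinite. Problem $(SP)$: minimize $\sum_s v(s)$ over $\mathbf{v}\in\mathbb{R}^S$,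 $\bar\nu(s)$, and symmetric matrices $Z_s$ (size $\frac{d_s}{2}+1$), $W_s$ (size $\frac{d_s}{2}$), subject to, for all $s\in\mathcal{S}$: $\mathcal{H}^*\big(Z_s+\tfrac12(L_1W_sL_2^T+L_2W_sL_1^T)-L_2W_sL_2^T\big)=E_s\mathbf{v}-\beta Q(s)\mathbf{v}-R(s)\bar\nu(s)$; $\mathcal{H}(\bar\nu(s))\succeq0$; $\tfrac12\big(L_1^T\mathcal{H}(\bar\nu(s))L_2+L_2^T\mathcal{H}(\bar\nu(s))L_1\big)-L_2^T\mathcal{H}(\bar\nu(s))L_2\succeq0$; $e_1^T\bar\nu(s)=1$; $Z_s\succeq0$, $W_s\succeq0$. *)

theory Defs
  imports
    "HOL-Analysis.Analysis"
    "HOL-Computational_Algebra.Polynomial"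
    "Jordan_Normal_Form.Matrix"
begin

no_notation Finite_Cartesian_Product.vec_nth (infixl "$" 90)
no_notation Inner_Product.real_inner_class.inner (infix "\<bullet>" 70)
hide_const (open) Finite_Cartesian_Product.vec

text \<open>Vectors and matrices are those of \<^theory>\<open>Jordan_Normal_Form.Matrix\<close>, because the dimensions
  depend on the state. All indices start at 0; in particular the states are
  \<open>0, \<dots>, S - 1\<close> instead of \<open>1, \<dots>, S\<close>.\<close>

section \<open>Nonnegative polynomials, moments, matrices\<close>

definition nonneg_polys :: "real poly set" where
  "nonneg_polys = {f. \<forall>x\<in>{0..1}. 0 \<le> poly f x}"

text \<open>\<open>moment_space n\<close> consists of the vectors of the moments of order \<open>0, \<dots>, n\<close>.\<close>

definition moment_space :: "nat \<Rightarrow> real vec set" where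
  "moment_space n = {vec (n + 1) (\<lambda>i. \<integral>x. x ^ i \<partial>\<mu>) | \<mu> :: real measure.
     finite_measure \<mu> \<and> sets \<mu> = sets borel \<and> emeasure \<mu> (- {0..1}) = 0}"

definition symmetric_mat :: "nat \<Rightarrow> real mat \<Rightarrow> bool" where
  "symmetric_mat k M \<longleftrightarrow> M \<in> carrier_mat k k \<and> transpose_mat M = M"

definition psd :: "real mat \<Rightarrow> bool" where
  "psd M \<longleftrightarrow> symmetric_mat (dim_row M) M \<and>
     (\<forall>x\<in>carrier_vec (dim_row M). 0 \<le> x \<bullet> (M *\<^sub>v x))"

text \<open>\<open>hankel\<close> is meant for vectors of odd dimension \<open>2 * k - 1\<close>, and \<open>hankel_adjoint\<close> for
  \<open>k \<times> k\<close> matrices.\<close>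

definition hankel :: "real vec \<Rightarrow> real mat" where
  "hankel a = (let k = (dim_vec a + 1) div 2 in mat k k (\<lambda>(i, j). a $ (i + j)))"

definition hankel_adjoint :: "real mat \<Rightarrow> real vec" where
  "hankel_adjoint M = (let k = dim_row M in
     vec (2 * k - 1) (\<lambda>l. \<Sum>(i, j) \<in> {(i, j). i < k \<and> j < k \<and> i + j = l}. M $$ (i, j)))"

definition L1 :: "nat \<Rightarrow> real mat" where
  "L1 n = 1\<^sub>m n @\<^sub>r 0\<^sub>m 1 n"

definition L2 :: "nat \<Rightarrow> real mat" where
  "L2 n = 0\<^sub>m 1 n @\<^sub>r 1\<^sub>m n"


section \<open>Single-controller polynomial games on \<open>[0, 1]\<close>\<close>

text \<open>\<open>reward_coeff G s i j\<close> is the coefficient of \<open>a\<^sub>1 ^ i * a\<^sub>2 ^ j\<close> in the payoff at \<open>s\<close>, used for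
  \<open>i \<le> deg1 G s\<close> and \<open>j \<le> deg2 G s\<close> only. \<open>trans G s' s\<close> is the probability of moving from
  \<open>s\<close> to \<open>s'\<close>, as a polynomial in the action \<open>a\<^sub>1\<close>.\<close>

record polynomial_game =
  num_states :: nat
  discount :: real
  deg1 :: "nat \<Rightarrow> nat"
  deg2 :: "nat \<Rightarrow> nat"
  reward_coeff :: "nat \<Rightarrow> nat \<Rightarrow> nat \<Rightarrow> real"
  trans :: "nat \<Rightarrow> nat \<Rightarrow> real poly"

definition single_controller_game :: "polynomial_game \<Rightarrow> bool" where
  "single_controller_game G \<longleftrightarrow>
     0 < num_states G \<and>
     0 \<le> discount G \<and> discount G < 1 \<and>
     (\<forall>s<num_states G.
        0 < deg1 G s \<and> even (deg1 G s) \<and>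
        0 < deg2 G s \<and> even (deg2 G s) \<and>
        (\<forall>s'<num_states G. degree (trans G s' s) \<le> deg1 G s) \<and>
        (\<forall>x\<in>{0..1}. (\<forall>s'<num_states G. 0 \<le> poly (trans G s' s) x) \<and>
                     (\<Sum>s'<num_states G. poly (trans G s' s) x) = 1))"

definition objective :: "polynomial_game \<Rightarrow> real vec \<Rightarrow> real" where
  "objective G v = (\<Sum>s<num_states G. v $ s)"


section \<open>The polynomial optimization problem \<open>(P')\<close>\<close>

definition constraint_poly ::
    "polynomial_game \<Rightarrow> real vec \<Rightarrow> (nat \<Rightarrow> real vec) \<Rightarrow> nat \<Rightarrow> real poly" where
  "constraint_poly G v \<nu> s =
     [:v $ s:]
     - (\<Sum>i\<le>deg1 G s. \<Sum>j\<le>deg2 G s. monom (reward_coeff G s i j * \<nu> s $ j) i)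
     - Polynomial.smult (discount G) (\<Sum>s'<num_states G. Polynomial.smult (v $ s') (trans G s' s))"

definition feasible_P :: "polynomial_game \<Rightarrow> real vec \<Rightarrow> (nat \<Rightarrow> real vec) \<Rightarrow> bool" where
  "feasible_P G v \<nu> \<longleftrightarrow>
     v \<in> carrier_vec (num_states G) \<and>
     (\<forall>s<num_states G.
        constraint_poly G v \<nu> s \<in> nonneg_polys \<and>
        \<nu> s \<in> moment_space (deg2 G s) \<and>
        \<nu> s $ 0 = 1)"

definition optimal_P :: "polynomial_game \<Rightarrow> real vec \<Rightarrow> (nat \<Rightarrow> real vec) \<Rightarrow> bool" where
  "optimal_P G v \<nu> \<longleftrightarrow> feasible_P G v \<nu> \<and>
     (\<forall>v' \<nu>'. feasible_P G v' \<nu>' \<longrightarrow> objective G v \<le> objective G v')"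

text \<open>Optimal values are infima in the extended reals, so that infeasible and unbounded problems
  have the values \<open>\<infinity>\<close> and \<open>-\<infinity>\<close>.\<close>

definition value_P :: "polynomial_game \<Rightarrow> ereal" where
  "value_P G = Inf {ereal (objective G v) | v \<nu>. feasible_P G v \<nu>}"


section \<open>The semidefinite program \<open>(SP)\<close>\<close>

definition R_mat :: "polynomial_game \<Rightarrow> nat \<Rightarrow> real mat" where
  "R_mat G s = mat (deg1 G s + 1) (deg2 G s + 1) (\<lambda>(i, j). reward_coeff G s i j)"

definition Q_mat :: "polynomial_game \<Rightarrow> nat \<Rightarrow> real mat" where
  "Q_mat G s = mat (deg1 G s + 1) (num_states G) (\<lambda>(i, s'). coeff (trans G s' s) i)"

definition E_mat :: "polynomial_game \<Rightarrow> nat \<Rightarrow> real mat" where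
  "E_mat G s = mat (deg1 G s + 1) (num_states G) (\<lambda>(i, s'). if i = 0 \<and> s' = s then 1 else 0)"

definition feasible_SP ::
    "polynomial_game \<Rightarrow> real vec \<Rightarrow> (nat \<Rightarrow> real vec) \<Rightarrow> (nat \<Rightarrow> real mat) \<Rightarrow> (nat \<Rightarrow> real mat) \<Rightarrow> bool"
  where
  "feasible_SP G v \<nu> Z W \<longleftrightarrow>
     v \<in> carrier_vec (num_states G) \<and>
     (\<forall>s<num_states G.
        \<nu> s \<in> carrier_vec (deg2 G s + 1) \<and>
        symmetric_mat (deg1 G s div 2 + 1) (Z s) \<and>
        symmetric_mat (deg1 G s div 2) (W s) \<and>
        (let A = L1 (deg1 G s div 2); B = L2 (deg1 G s div 2) in
           hankel_adjoint
             (Z s + (1/2) \<cdot>\<^sub>m (A * W s * transpose_mat B + B * W s * transpose_mat A)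
              - B * W s * transpose_mat B)
           = E_mat G s *\<^sub>v v - discount G \<cdot>\<^sub>v (Q_mat G s *\<^sub>v v) - R_mat G s *\<^sub>v \<nu> s) \<and>
        psd (hankel (\<nu> s)) \<and>
        (let A = L1 (deg2 G s div 2); B = L2 (deg2 G s div 2); H = hankel (\<nu> s) in
           psd ((1/2) \<cdot>\<^sub>m (transpose_mat A * H * B + transpose_mat B * H * A)
                - transpose_mat B * H * B)) \<and>
        unit_vec (deg2 G s + 1) 0 \<bullet> \<nu> s = 1 \<and>
        psd (Z s) \<and> psd (W s))"

definition optimal_SP ::
    "polynomial_game \<Rightarrow> real vec \<Rightarrow> (nat \<Rightarrow> real vec) \<Rightarrow> (nat \<Rightarrow> real mat) \<Rightarrow> (nat \<Rightarrow> real mat) \<Rightarrow> bool"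
  where
  "optimal_SP G v \<nu> Z W \<longleftrightarrow> feasible_SP G v \<nu> Z W \<and>
     (\<forall>v' \<nu>' Z' W'. feasible_SP G v' \<nu>' Z' W' \<longrightarrow> objective G v \<le> objective G v')"

definition value_SP :: "polynomial_game \<Rightarrow> ereal" where
  "value_SP G = Inf {ereal (objective G v) | v \<nu> Z W. feasible_SP G v \<nu> Z W}"

end

theory Submission
  imports
    Defs
    "HOL-Computational_Algebra.Fundamental_Theorem_Algebra"
    "HOL-Probability.Helly_Selection"
    "HOL-Probability.Probability_Mass_Function"
begin

text \<open>The constraints of the two problems correspond state by state.

  \<^bold>\<open>Polynomials.\<close> By the Lukacs theorem a polynomial of degree at most \<open>2 * n\<close> is nonnegative on \<open>[0, 1]\<close> if
  and only if it is a sum of squares \<open>p\<^sup>2\<close> with \<open>degree p \<le> n\<close> and weighted squares \<open>x * (1 - x) * p\<^sup>2\<close> with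
  \<open>degree p < n\<close> (\<open>lukacs\<close>). Sums of squares are the polynomials \<open>m \<bullet> (Z *\<^sub>v m)\<close> in the vector \<open>m\<close> of
  powers of \<open>x\<close> with \<open>Z\<close> positive semidefinite, and the coefficients of such a polynomial are the
  antidiagonal sums of \<open>Z\<close>. The shift matrices \<open>L1\<close> and \<open>L2\<close> produce the factor \<open>x * (1 - x)\<close> of the
  second matrix \<open>W\<close>. Hence the linear equation in \<open>Z\<close> and \<open>W\<close> is solvable exactly for nonnegative
  constraint polynomials (\<open>nonneg_polys_iff_gram\<close>).

  The Lukacs theorem is proved by induction on the degree, splitting off roots. This works because the
  products \<open>x ^ a * (1 - x) ^ b * p\<^sup>2\<close> generate cones that are closed under multiplication, and these
  generators reduce to the two kinds above at the end.

  \<^bold>\<open>Moments.\<close> The Hankel matrix of \<open>\<nu>\<close> and its localizing matrix are the quadratic forms that send \<open>p\<close> to the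
  values at \<open>p\<^sup>2\<close> and \<open>x * (1 - x) * p\<^sup>2\<close> of the linear functional \<open>riesz\<close> with \<open>x ^ i \<mapsto> \<nu> $ i\<close>. By the Lukacs
  theorem both are positive semidefinite if and only if this functional is nonnegative on all nonnegative
  polynomials of degree at most \<open>2 * n\<close>. Moment vectors have this property since integration is monotone.
  Conversely, a normalized \<open>\<nu>\<close> with this property is a moment vector: otherwise the moment vector closest
  to \<open>\<nu>\<close> would yield a separating hyperplane, that is, a nonnegative polynomial with a negative value
  (\<open>moment_space_of_riesz_nonneg\<close>). A closest one exists because the probability measures on \<open>[0, 1]\<close>
  are compact under weak convergence.\<close>

no_notation Finite_Cartesian_Product.vec_nth (infixl "$" 90)
no_notation Inner_Product.real_inner_class.inner (infix "\<bullet>" 70)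
hide_const (open) Finite_Cartesian_Product.vec

section \<open>Polynomials that are nonnegative on the unit interval\<close>

text \<open>The bound \<open>d\<close> is on the degree of a generator as a formal product, so that the generators of the
  cones for \<open>d\<close> and \<open>e\<close> multiply to a generator of the cone for \<open>d + e\<close>. Arbitrary exponents
  \<open>a\<close> and \<open>b\<close> avoid the distinction between even and odd degrees that the usual form of the
  Lukacs representation needs.\<close>
inductive interval_cone :: "nat \<Rightarrow> real poly \<Rightarrow> bool" for d where
  generator: "a + b + 2 * degree p \<le> d \<Longrightarrow> interval_cone d ([:0, 1:] ^ a * [:1, -1:] ^ b * p\<^sup>2)"
| sum: "interval_cone d f \<Longrightarrow> interval_cone d g \<Longrightarrow> interval_cone d (f + g)"

lemma interval_cone_mult_generator:
  assumes "interval_cone e g" "a + b + 2 * degree p \<le> d"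
  shows "interval_cone (d + e) ([:0, 1:] ^ a * [:1, -1:] ^ b * p\<^sup>2 * g)"
  using assms(1)
proof induction
  case (generator a' b' q)
  have "degree (p * q) \<le> degree p + degree q"
    by (rule degree_mult_le)
  then have "interval_cone (d + e) ([:0, 1:] ^ (a + a') * [:1, -1:] ^ (b + b') * (p * q)\<^sup>2)"
    using generator assms(2) by (intro interval_cone.generator) linarith
  moreover have "[:0, 1:] ^ (a + a') * [:1, -1:] ^ (b + b') * (p * q)\<^sup>2 =
      [:0, 1:] ^ a * [:1, -1:] ^ b * p\<^sup>2 * ([:0, 1:] ^ a' * [:1, -1:] ^ b' * q\<^sup>2)"
    by (simp add: power_add power_mult_distrib mult_ac)
  ultimately show ?case by simp
next
  case (sum f g)
  then show ?case
    by (metis distrib_left interval_cone.sum)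
qed

lemma interval_cone_mult:
  assumes "interval_cone d f" "interval_cone e g"
  shows "interval_cone (d + e) (f * g)"
  using assms(1)
proof induction
  case (generator a b p)
  then show ?case using interval_cone_mult_generator[OF assms(2)] by blast
next
  case (sum f1 f2)
  then show ?case by (metis distrib_right interval_cone.sum)
qed

lemma interval_cone_const:
  assumes "0 \<le> c"
  shows "interval_cone 0 [:c:]"
  using interval_cone.generator[of 0 0 "[:sqrt c:]" 0] assms
  by (simp add: power2_eq_square)

lemma interval_cone_X: "interval_cone 1 [:0, 1:]"
  using interval_cone.generator[of 1 0 1 1] by simp

lemma interval_cone_1_minus_X: "interval_cone 1 [:1, -1:]"
  using interval_cone.generator[of 0 1 1 1] by simp

lemma interval_cone_square:
  "2 * degree p \<le> d \<Longrightarrow> interval_cone d (p\<^sup>2)"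
  using interval_cone.generator[of 0 0 p d] by simp

text \<open>A linear polynomial is the combination of \<open>x\<close> and \<open>1 - x\<close> with its values at 1 and at 0 as
  coefficients.\<close>
lemma interval_cone_linear:
  assumes "0 \<le> a" "0 \<le> b"
  shows "interval_cone 1 (Polynomial.smult a [:0, 1:] + Polynomial.smult b [:1, -1:])"
  using interval_cone.sum[OF interval_cone_mult[OF interval_cone_const[OF assms(1)] interval_cone_X]
      interval_cone_mult[OF interval_cone_const[OF assms(2)] interval_cone_1_minus_X]]
  by simp

text \<open>Away from the finitely many bad points of \<open>q\<close> the quotient \<open>g\<close> is nonnegative by its sign; at
  these points it is so by continuity.\<close>
lemma poly_nonneg_cancel:
  fixes g q :: "real poly"
  assumes "finite {x \<in> {0..1}. poly q x \<le> 0}"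
    and "\<And>x. x \<in> {0..1} \<Longrightarrow> 0 \<le> poly (q * g) x"
  shows "\<forall>x\<in>{0..1}. 0 \<le> poly g x"
proof
  fix x :: real assume x: "x \<in> {0..1}"
  let ?Z = "{x \<in> {0..1}. poly q x \<le> 0}"
  have pos: "0 \<le> poly g y" if "y \<in> {0..1} - ?Z" for y
    using assms(2)[of y] that by (auto simp: zero_le_mult_iff)
  have "x islimpt {0..1}"
    using x by simp
  moreover have "?Z \<union> ({0..1} - ?Z) = {0..1}"
    by auto
  ultimately have "x islimpt ({0..1} - ?Z)"
    using islimpt_Un_finite[OF assms(1)] by metis
  then have "x islimpt {y. 0 \<le> poly g y}"
    by (rule islimpt_subset) (use pos in blast)
  moreover have "closed {y. 0 \<le> poly g y}"
    by (intro closed_Collect_le continuous_intros)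
  ultimately show "0 \<le> poly g x"
    by (auto simp: closed_limpt)
qed

text \<open>A complex root \<open>a + b * \<i>\<close> that is not real comes with its conjugate, and the quadratic below is the
  product of the two linear factors.\<close>
lemma real_poly_root_cases:
  fixes f :: "real poly"
  assumes "0 < degree f"
  obtains r where "poly f r = 0"
  | a b where "b \<noteq> 0" "[:a\<^sup>2 + b\<^sup>2, - 2 * a, 1:] dvd f"
proof -
  let ?F = "map_poly complex_of_real f"
  have "degree ?F = degree f" by (rule degree_map_poly) simp
  then have "\<not> constant (poly ?F)"
    using assms by (simp add: constant_degree)
  then obtain z where z: "poly ?F z = 0"
    using fundamental_theorem_of_algebra by blast
  show ?thesis
  proof (cases "Im z = 0")
    case True
    then have "z = complex_of_real (Re z)"
      by (simp add: complex_eq_iff)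
    moreover have "poly ?F (complex_of_real x) = complex_of_real (poly f x)" for x
      by (induction f) (auto simp: map_poly_pCons)
    ultimately have "complex_of_real (poly f (Re z)) = 0"
      using z by metis
    then show ?thesis using that(1) by simp
  next
    case False
    define q where "q = [:(Re z)\<^sup>2 + (Im z)\<^sup>2, - 2 * Re z, 1:]"
    have q: "q \<noteq> 0" "degree q = 2" by (auto simp: q_def)
    define s where "s = f mod q"
    \<comment> \<open>The remainder is real, of degree at most 1, and vanishes at the non-real number \<open>z\<close>.\<close>
    have "degree s \<le> 1"
      using degree_mod_less[OF q(1), of f] q(2) unfolding s_def by auto
    define c d where "c = coeff s 0" and "d = coeff s 1"
    have s: "s = [:c, d:]"
    proof (rule poly_eqI)
      fix i show "coeff s i = coeff [:c, d:] i"
        using \<open>degree s \<le> 1\<close>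
        by (cases "i \<le> 1") (auto simp: c_def d_def le_Suc_eq coeff_eq_0 coeff_pCons split: nat.splits)
    qed
    have zq: "poly (map_poly complex_of_real q) z = 0"
      by (simp add: q_def map_poly_pCons complex_eq_iff power2_eq_square algebra_simps)
    have "?F = map_poly complex_of_real (q * (f div q) + s)"
      by (simp add: s_def)
    also have "\<dots> = map_poly complex_of_real q * map_poly complex_of_real (f div q) + map_poly complex_of_real s"
      by (intro poly_eqI) (simp add: coeff_map_poly coeff_mult)
    finally have "poly ?F z = poly (map_poly complex_of_real s) z"
      using zq by simp
    then have "complex_of_real c + z * complex_of_real d = 0"
      using z by (simp add: s map_poly_pCons)
    then have "d = 0" "c = 0"
      using False by (auto simp: complex_eq_iff)
    then have "f mod q = 0" using s unfolding s_def by simp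
    then have "q dvd f" by (simp add: dvd_eq_mod_eq_0)
    then show ?thesis using that(2)[of "Im z" "Re z"] False by (simp add: q_def)
  qed
qed

text \<open>An interior root is a local minimum, so the derivative vanishes there too.\<close>
lemma nonneg_interior_root_double:
  fixes f :: "real poly"
  assumes "\<And>x. x \<in> {0..1} \<Longrightarrow> 0 \<le> poly f x" "0 < r" "r < 1" "poly f r = 0"
  shows "[:-r, 1:]\<^sup>2 dvd f"
proof -
  obtain g where g: "f = [:-r, 1:] * g"
    using assms(4) by (metis dvdE poly_eq_0_iff_dvd)
  then have "poly f = (\<lambda>x. (x - r) * poly g x)"
    by (simp only: poly_mult fun_eq_iff) (simp add: algebra_simps)
  then have "DERIV (poly f) r :> poly g r"
    by (auto intro!: derivative_eq_intros)
  moreover have "0 < min r (1 - r)" using assms by simp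
  moreover have "\<forall>y. \<bar>r - y\<bar> < min r (1 - r) \<longrightarrow> poly f r \<le> poly f y"
    using assms by (auto simp: abs_if split: if_splits)
  ultimately have "poly g r = 0"
    using DERIV_local_min by blast
  then show ?thesis
    using g by (metis poly_eq_0_iff_dvd power2_eq_square mult_dvd_mono dvd_refl)
qed

text \<open>Induction on the degree, splitting off the factor of one root (or of a conjugate pair, or of a double
  root). A linear factor with a root \<open>r \<le> 0\<close> or \<open>r \<ge> 1\<close> is, up to sign, a nonnegative combination of
  \<open>x\<close> and \<open>1 - x\<close>; the quadratic factors are sums of squares. As the cones multiply, the product of the
  factors stays in the cone of the right degree.\<close>
lemma interval_cone_nonneg:
  fixes f :: "real poly"
  assumes "\<forall>x\<in>{0..1}. 0 \<le> poly f x"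
  shows "interval_cone (degree f) f"
  using assms
proof (induction "degree f" arbitrary: f rule: less_induct)
  case less
  \<comment> \<open>It suffices to split off a factor of the cone that is positive on the interval up to finitely
    many points.\<close>
  have split: "interval_cone (degree f) f"
    if "f = q * g" "interval_cone (degree q) q" "0 < degree q" "f \<noteq> 0"
      "finite {x \<in> {0..1}. poly q x \<le> 0}" for q g
  proof -
    have "degree f = degree q + degree g"
      using that by (metis degree_mult_eq mult_eq_0_iff)
    moreover have "interval_cone (degree g) g"
      using poly_nonneg_cancel[OF that(5)] less that calculation by auto
    ultimately show ?thesis
      using interval_cone_mult[OF that(2)] that(1) by metis
  qed
  show ?case
  proof (cases "degree f = 0")
    case True
    then obtain c where "f = [:c:]" by (metis degree_eq_zeroE)
    then show ?thesis using less(2) interval_cone_const True by auto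
  next
    case False
    then have f0: "f \<noteq> 0" by auto
    from False have "0 < degree f" by simp
    then show ?thesis
    proof (cases rule: real_poly_root_cases)
      case (1 r)
      then have dvd: "[:-r, 1:] dvd f" by (simp add: poly_eq_0_iff_dvd)
      consider "r \<le> 0" | "0 < r" "r < 1" | "1 \<le> r" by linarith
      then show ?thesis
      proof cases
        case 1
        obtain g where f: "f = [:-r, 1:] * g" using dvd by blast
        moreover have "interval_cone (degree [:-r, 1:]) [:-r, 1:]"
          using interval_cone_linear[of "1 - r" "- r"] 1 by simp
        moreover have "finite {x \<in> {0..1}. poly [:-r, 1:] x \<le> 0}"
          by (rule finite_subset[of _ "{0}"]) (use 1 in auto)
        ultimately show ?thesis using split[OF f] f0 by simp
      next
        case 2
        obtain g where f: "f = [:-r, 1:]\<^sup>2 * g"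
          using nonneg_interior_root_double[of f r] 2 \<open>poly f r = 0\<close> less(2) by blast
        moreover have "interval_cone (degree ([:-r, 1:]\<^sup>2)) ([:-r, 1:]\<^sup>2)"
          by (intro interval_cone_square) (simp add: degree_power_eq)
        moreover have "finite {x \<in> {0..1}. poly ([:-r, 1:]\<^sup>2) x \<le> 0}"
          by (rule finite_subset[of _ "{r}"]) auto
        ultimately show ?thesis using split[OF f] f0 by (simp add: degree_power_eq)
      next
        case 3
        obtain g where "f = [:-r, 1:] * g" using dvd by blast
        then have f: "f = [:r, -1:] * (- g)" by simp
        moreover have "interval_cone (degree [:r, -1:]) [:r, -1:]"
          using interval_cone_linear[of "r - 1" "r"] 3 by simp
        moreover have "finite {x \<in> {0..1}. poly [:r, -1:] x \<le> 0}"
          by (rule finite_subset[of _ "{1}"]) (use 3 in auto)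
        ultimately show ?thesis using split[OF f] f0 by simp
      qed
    next
      case (2 a b)
      define q where "q = [:a\<^sup>2 + b\<^sup>2, - 2 * a, 1:]"
      have q: "q = [:-a, 1:]\<^sup>2 + [:b:]\<^sup>2"
        by (simp add: q_def power2_eq_square)
      have deg: "degree q = 2" by (simp add: q_def)
      obtain g where f: "f = q * g" using 2 q_def by blast
      moreover have "interval_cone (degree q) q"
        unfolding q using deg[unfolded q] by (auto intro!: interval_cone.sum interval_cone_square)
      moreover have "0 < poly q x" for x
        using 2 unfolding q by (simp add: add_nonneg_pos)
      then have "finite {x \<in> {0..1}. poly q x \<le> 0}"
        by (simp add: not_le[symmetric])
      ultimately show ?thesis using split[OF f] f0 deg by simp
    qed
  qed
qed

text \<open>The weight \<open>[:0, 1, -1:]\<close> is \<open>x * (1 - x)\<close>. The bound on the weighted squares is strict, instead of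
  \<open>degree p \<le> n - 1\<close>, so that there are no weighted squares for \<open>n = 0\<close>.\<close>
inductive lukacs_cone :: "nat \<Rightarrow> real poly \<Rightarrow> bool" for n where
  square: "degree p \<le> n \<Longrightarrow> lukacs_cone n (p\<^sup>2)"
| weighted_square: "degree p < n \<Longrightarrow> lukacs_cone n ([:0, 1, -1:] * p\<^sup>2)"
| sum: "lukacs_cone n f \<Longrightarrow> lukacs_cone n g \<Longrightarrow> lukacs_cone n (f + g)"

text \<open>Even powers of \<open>x\<close> and \<open>1 - x\<close> are absorbed into the square. A single remaining factor \<open>x\<close> or
  \<open>1 - x\<close> is removed with \<open>w = w\<^sup>2 + x * (1 - x)\<close>, valid for both of them; the parity of the degree
  bound \<open>2 * n\<close> leaves room for the extra degree of \<open>w\<^sup>2\<close>.\<close>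
lemma interval_cone_imp_lukacs_cone:
  assumes "interval_cone d f" "d \<le> 2 * n"
  shows "lukacs_cone n f"
  using assms(1)
proof induction
  case (generator a b p)
  define q where "q = [:0, 1:] ^ (a div 2) * [:1, -1:] ^ (b div 2) * p"
  have "degree q \<le> degree ([:0, 1:] ^ (a div 2) * [:1, -1 :: real:] ^ (b div 2)) + degree p"
    unfolding q_def by (rule degree_mult_le)
  also have "\<dots> \<le> a div 2 + b div 2 + degree p"
    using degree_mult_le[of "[:0, 1 :: real:] ^ (a div 2)" "[:1, -1 :: real:] ^ (b div 2)"]
    by (simp add: degree_power_eq)
  finally have deg: "degree q \<le> a div 2 + b div 2 + degree p" .
  let ?X = "[:0, 1 :: real:]" and ?Y = "[:1, -1 :: real:]"
  have "?X ^ a = ?X ^ (a mod 2) * (?X ^ (a div 2))\<^sup>2" "?Y ^ b = ?Y ^ (b mod 2) * (?Y ^ (b div 2))\<^sup>2"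
    by (simp_all only: power_mult[symmetric] power_add[symmetric] mod_mult_div_eq mult.commute)
  then have eq: "?X ^ a * ?Y ^ b * p\<^sup>2 = ?X ^ (a mod 2) * ?Y ^ (b mod 2) * q\<^sup>2"
    by (simp only: q_def power_mult_distrib mult_ac)
  have split: "lukacs_cone n (w * q\<^sup>2)"
    if w: "w = ?X \<or> w = ?Y" and q: "degree q < n" for w
  proof -
    have "w * q\<^sup>2 = (w * q)\<^sup>2 + [:0, 1, -1:] * q\<^sup>2"
    proof -
      have "w = w\<^sup>2 + [:0, 1, -1:]" using w by (auto simp: power2_eq_square)
      then show ?thesis by (metis distrib_right power_mult_distrib)
    qed
    moreover have "degree (w * q) \<le> n"
      using degree_mult_le[of w q] w q by auto
    ultimately show ?thesis
      using lukacs_cone.sum lukacs_cone.square lukacs_cone.weighted_square q by metis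
  qed
  consider "even a" "even b" | "odd a" "even b" | "even a" "odd b" | "odd a" "odd b" by blast
  then have "lukacs_cone n (?X ^ (a mod 2) * ?Y ^ (b mod 2) * q\<^sup>2)"
  proof cases
    case 1
    then have "degree q \<le> n" using deg generator assms(2) by (auto elim!: evenE)
    then show ?thesis using 1 lukacs_cone.square by (simp add: even_iff_mod_2_eq_zero)
  next
    case 2
    then have "degree q < n" using deg generator assms(2) by (auto elim!: evenE oddE)
    then show ?thesis using split[of ?X] 2 by (simp add: odd_iff_mod_2_eq_one even_iff_mod_2_eq_zero)
  next
    case 3
    then have "degree q < n" using deg generator assms(2) by (auto elim!: evenE oddE)
    then show ?thesis using split[of ?Y] 3 by (simp add: odd_iff_mod_2_eq_one even_iff_mod_2_eq_zero)
  next
    case 4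
    then have "degree q < n" using deg generator assms(2) by (auto elim!: evenE oddE)
    then show ?thesis using lukacs_cone.weighted_square[of q n] 4 by (simp add: odd_iff_mod_2_eq_one)
  qed
  then show ?case using eq by simp
next
  case (sum f g)
  then show ?case by (simp add: lukacs_cone.sum)
qed

theorem lukacs:
  assumes "f \<in> nonneg_polys" "degree f \<le> 2 * n"
  shows "lukacs_cone n f"
  using interval_cone_imp_lukacs_cone[OF interval_cone_nonneg assms(2)] assms(1)
  by (simp add: nonneg_polys_def)

section \<open>Moments of measures on the unit interval\<close>

text \<open>The Riesz functional of the sequence \<open>y\<close>: integration, if \<open>y\<close> consists of the moments of a measure.\<close>
definition riesz :: "(nat \<Rightarrow> real) \<Rightarrow> real poly \<Rightarrow> real" where
  "riesz y f = (\<Sum>i\<le>degree f. coeff f i * y i)"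

lemma riesz_eq:
  assumes "degree f \<le> N"
  shows "riesz y f = (\<Sum>i\<le>N. coeff f i * y i)"
  unfolding riesz_def using assms
  by (intro sum.mono_neutral_left) (auto simp: coeff_eq_0)

lemma riesz_add: "riesz y (f + g) = riesz y f + riesz y g"
proof -
  let ?N = "max (degree f) (degree g)"
  have "degree (f + g) \<le> ?N" by (rule degree_add_le_max)
  then show ?thesis
    by (simp add: riesz_eq[of _ ?N] sum.distrib algebra_simps)
qed

lemma riesz_smult: "riesz y (Polynomial.smult c f) = c * riesz y f"
  by (simp add: riesz_eq[of _ "degree f"] degree_smult_le sum_distrib_left mult_ac)

lemma riesz_diff: "riesz y (f - g) = riesz y f - riesz y g"
  using riesz_add[of y "f - g" g] by simp

lemma riesz_0: "riesz y 0 = 0"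
  by (simp add: riesz_def)

lemma riesz_sum: "riesz y (\<Sum>i\<in>A. f i) = (\<Sum>i\<in>A. riesz y (f i))"
  by (induction A rule: infinite_finite_induct) (auto simp: riesz_add riesz_0)

lemma riesz_monom: "riesz y (monom c k) = c * y k"
  by (simp add: riesz_eq[of _ k] degree_monom_le if_distrib if_distribR cong: if_cong)

lemma riesz_nonneg_of_lukacs_cone:
  assumes "lukacs_cone n f"
    and "\<And>p. degree p \<le> n \<Longrightarrow> 0 \<le> riesz y (p\<^sup>2)"
    and "\<And>p. degree p < n \<Longrightarrow> 0 \<le> riesz y ([:0, 1, -1:] * p\<^sup>2)"
  shows "0 \<le> riesz y f"
  using assms(1)
proof induction
  case (sum f g)
  then show ?case by (simp add: riesz_add)
qed (fact assms)+

lemma integrable_power_unit_interval: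
  fixes \<mu> :: "real measure"
  assumes "finite_measure \<mu>" "sets \<mu> = sets borel" "AE x in \<mu>. x \<in> {0..1}"
  shows "integrable \<mu> (\<lambda>x. x ^ i)"
proof (rule finite_measure.integrable_const_bound[OF assms(1), of _ 1])
  show "AE x in \<mu>. norm (x ^ i) \<le> 1"
    using assms(3) by eventually_elim (auto simp: power_le_one)
  show "(\<lambda>x. x ^ i) \<in> borel_measurable \<mu>"
    using assms(2) by (simp cong: measurable_cong_sets)
qed

lemma riesz_moments:
  fixes \<mu> :: "real measure"
  assumes "finite_measure \<mu>" "sets \<mu> = sets borel" "AE x in \<mu>. x \<in> {0..1}"
  shows "riesz (\<lambda>i. \<integral>x. x ^ i \<partial>\<mu>) f = (\<integral>x. poly f x \<partial>\<mu>)"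
  unfolding riesz_def poly_altdef using integrable_power_unit_interval[OF assms]
  by (subst Bochner_Integration.integral_sum) auto

lemma moment_space_riesz_nonneg:
  assumes "\<nu> \<in> moment_space N" "f \<in> nonneg_polys" "degree f \<le> N"
  shows "0 \<le> riesz (\<lambda>i. \<nu> $ i) f"
proof -
  obtain \<mu> :: "real measure" where \<mu>: "finite_measure \<mu>" "sets \<mu> = sets borel" "emeasure \<mu> (- {0..1}) = 0"
    and \<nu>: "\<nu> = vec (N + 1) (\<lambda>i. \<integral>x. x ^ i \<partial>\<mu>)"
    using assms(1) unfolding moment_space_def by blast
  have "- {0..1} \<in> null_sets \<mu>"
    using \<mu> by (auto simp: null_sets_def)
  then have ae: "AE x in \<mu>. x \<in> {0..1}"
    using AE_not_in[of "- {0..1}" \<mu>] by simp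
  have "riesz (\<lambda>i. \<nu> $ i) f = riesz (\<lambda>i. \<integral>x. x ^ i \<partial>\<mu>) f"
    unfolding riesz_def \<nu> using assms(3) by (intro sum.cong) auto
  also have "\<dots> = (\<integral>x. poly f x \<partial>\<mu>)"
    by (rule riesz_moments[OF \<mu>(1,2) ae])
  also have "\<dots> \<ge> 0"
    using ae by (intro integral_nonneg_AE) (auto simp: assms(2)[unfolded nonneg_polys_def, simplified])
  finally show ?thesis .
qed

text \<open>Compactness of the probability measures on \<open>[0, 1]\<close>, by Helly's selection theorem. Powers are not
  bounded on the real line, so weak convergence is tested with the powers of the projection onto
  \<open>[0, 1]\<close>, and the limit measure is pushed forward along this projection.\<close>
lemma pmf_moments_convergent_subseq:
  fixes p :: "nat \<Rightarrow> real pmf"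
  assumes supp: "\<And>k. set_pmf (p k) \<subseteq> {0..1}"
  obtains r :: "nat \<Rightarrow> nat" and \<mu> :: "real measure"
  where "strict_mono r" "prob_space \<mu>" "sets \<mu> = sets borel" "emeasure \<mu> (- {0..1}) = 0"
    "\<And>i. (\<lambda>k. measure_pmf.expectation (p (r k)) (\<lambda>x. x ^ i)) \<longlonglongrightarrow> (\<integral>x. x ^ i \<partial>\<mu>)"
proof -
  define D where "D k = distr (measure_pmf (p k)) borel (\<lambda>x. x)" for k
  have D: "real_distribution (D k)" for k
    unfolding D_def by (rule prob_space.real_distribution_distr) (auto intro: prob_space_measure_pmf)
  have "measure (D k) {-1<..1} = 1" for k
  proof -
    have "measure (D k) {-1<..1} = measure_pmf.prob (p k) {-1<..1}"
      by (simp add: D_def measure_distr)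
    also have "\<dots> = 1"
      using supp[of k] by (subst measure_pmf.prob_eq_1) (auto simp: AE_measure_pmf_iff)
    finally show ?thesis .
  qed
  then have "tight D"
    unfolding tight_def using D
    by (intro conjI allI impI exI[of _ "-1 :: real"] exI[of _ "1 :: real"]) auto
  from tight_imp_convergent_subsubsequence[OF this strict_mono_id]
  obtain r M where r: "strict_mono (r :: nat \<Rightarrow> nat)" and M: "real_distribution M"
    and weak: "weak_conv_m (D \<circ> id \<circ> r) M"
    by blast
  interpret M: real_distribution M by fact
  define c :: "real \<Rightarrow> real" where "c x = max 0 (min 1 x)" for x
  have [measurable]: "c \<in> borel_measurable borel" unfolding c_def by measurable
  have cont: "isCont (\<lambda>x. c x ^ i) x" for x i
    unfolding c_def by (intro continuous_intros)
  have bound: "norm (c x ^ i) \<le> 1" for x i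
    by (auto simp: c_def power_le_one)
  define \<mu> where "\<mu> = distr M borel c"
  have "(\<lambda>k. measure_pmf.expectation (p (r k)) (\<lambda>x. x ^ i)) \<longlonglongrightarrow> (\<integral>x. x ^ i \<partial>\<mu>)" for i
  proof -
    have "(\<lambda>k. integral\<^sup>L ((D \<circ> id \<circ> r) k) (\<lambda>x. c x ^ i)) \<longlonglongrightarrow> integral\<^sup>L M (\<lambda>x. c x ^ i)"
      using D M weak cont bound
      by (intro weak_conv_imp_integral_bdd_continuous_conv) (auto simp: comp_def)
    moreover have "integral\<^sup>L ((D \<circ> id \<circ> r) k) (\<lambda>x. c x ^ i) = measure_pmf.expectation (p (r k)) (\<lambda>x. x ^ i)" for k
    proof -
      have "c x = x" if "x \<in> set_pmf (p (r k))" for x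
        using supp[of "r k"] that by (auto simp: c_def)
      then show ?thesis
        by (auto simp: D_def integral_distr AE_measure_pmf_iff intro!: integral_cong_AE)
    qed
    moreover have "integral\<^sup>L M (\<lambda>x. c x ^ i) = (\<integral>x. x ^ i \<partial>\<mu>)"
      by (simp add: \<mu>_def integral_distr)
    ultimately show ?thesis by simp
  qed
  moreover have "prob_space \<mu>" unfolding \<mu>_def by (intro M.prob_space_distr) auto
  moreover have "emeasure \<mu> (- {0..1}) = 0"
  proof -
    have "c -` (- {0..1}) \<inter> space M = {}" by (auto simp: c_def)
    then show ?thesis by (simp add: \<mu>_def emeasure_distr)
  qed
  moreover have "sets \<mu> = sets borel" by (simp add: \<mu>_def)
  ultimately show ?thesis using that r by blast
qed

text \<open>The optimality condition at an end point of a segment: \<open>- 2 * (\<Sum>i\<in>I. a i * b i)\<close> is the derivative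
  at \<open>t = 0\<close> of the right-hand side.\<close>
lemma first_variation:
  fixes a b :: "nat \<Rightarrow> real"
  assumes "\<And>t. 0 < t \<Longrightarrow> t \<le> 1 \<Longrightarrow> (\<Sum>i\<in>I. (a i)\<^sup>2) \<le> (\<Sum>i\<in>I. (a i - t * b i)\<^sup>2)"
  shows "(\<Sum>i\<in>I. a i * b i) \<le> 0"
proof (rule ccontr)
  define A where "A = (\<Sum>i\<in>I. a i * b i)"
  define B where "B = (\<Sum>i\<in>I. (b i)\<^sup>2)"
  assume "\<not> ?thesis"
  then have A: "0 < A" by (simp add: A_def)
  have B: "0 \<le> B" unfolding B_def by (simp add: sum_nonneg)
  have "2 * A \<le> t * B" if "0 < t" "t \<le> 1" for t
  proof -
    have "(\<Sum>i\<in>I. (a i - t * b i)\<^sup>2) = (\<Sum>i\<in>I. (a i)\<^sup>2) - t * (2 * A) + t * (t * B)"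
      by (simp add: A_def B_def sum_distrib_left sum_subtractf sum.distrib power2_eq_square algebra_simps)
    then have "t * (2 * A) \<le> t * (t * B)" using assms[OF that] by simp
    then show ?thesis using that by simp
  qed
  \<comment> \<open>The summand 1 covers the case \<open>B = 0\<close>.\<close>
  from this[of "min 1 (A / (B + 1))"] have "2 * A \<le> min 1 (A / (B + 1)) * B"
    using A B by simp
  also have "\<dots> \<le> A / (B + 1) * B" using B by (intro mult_right_mono) auto
  also have "\<dots> \<le> A" using A B by (simp add: field_simps)
  finally show False using A by simp
qed

text \<open>The vector \<open>m\<close> of moments of a probability measure that is closest to \<open>\<nu>\<close> exists by compactness.
  Moving its measure towards the point mass at \<open>x\<close> cannot decrease the distance; this says that the
  polynomial \<open>f = (\<Sum>i. a i * (m i - X ^ i))\<close> with \<open>a = \<nu> - m\<close> is nonnegative at \<open>x\<close>. Applied to \<open>f\<close>, the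
  functional of \<open>\<nu>\<close> gives \<open>- (\<Sum>i. (a i)\<^sup>2)\<close>, so \<open>\<nu> = m\<close>.

  The minimum is approached by measures with finite support, for which mixtures with point masses are
  easy to integrate; only the limit is a general measure.\<close>
lemma moment_space_of_riesz_nonneg:
  fixes \<nu> :: "real vec"
  assumes \<nu>: "\<nu> \<in> carrier_vec (N + 1)" "\<nu> $ 0 = 1"
    and nonneg: "\<And>f. f \<in> nonneg_polys \<Longrightarrow> degree f \<le> N \<Longrightarrow> 0 \<le> riesz (\<lambda>i. \<nu> $ i) f"
  shows "\<nu> \<in> moment_space N"
proof -
  define P where "P = {q :: real pmf. finite (set_pmf q) \<and> set_pmf q \<subseteq> {0..1}}"
  define E where "E q i = measure_pmf.expectation q (\<lambda>x. x ^ i)" for q :: "real pmf" and i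
  define D where "D q = (\<Sum>i\<le>N. (\<nu> $ i - E q i)\<^sup>2)" for q
  define d where "d = Inf (D ` P)"
  have "return_pmf 0 \<in> P" by (simp add: P_def)
  then have ne: "D ` P \<noteq> {}" by blast
  have bdd: "bdd_below (D ` P)"
    by (rule bdd_belowI[of _ 0]) (auto simp: D_def sum_nonneg)
  have "\<exists>q\<in>P. D q < d + inverse (real (Suc k))" for k
    using cInf_lessD[OF ne, of "d + inverse (real (Suc k))"] by (auto simp: d_def)
  then obtain q where q: "\<And>k. q k \<in> P" "\<And>k. D (q k) < d + inverse (real (Suc k))"
    by metis
  have lower: "d \<le> D p" if "p \<in> P" for p
    unfolding d_def using bdd that by (intro cInf_lower) auto
  have "(\<lambda>k. D (q k)) \<longlonglongrightarrow> d"
  proof (rule tendsto_sandwich[OF always_eventually always_eventually tendsto_const])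
    show "(\<lambda>k. d + inverse (real (Suc k))) \<longlonglongrightarrow> d"
      using tendsto_add[OF tendsto_const LIMSEQ_inverse_real_of_nat, of d] by simp
  qed (use q lower in \<open>auto intro: less_imp_le simp del: of_nat_Suc\<close>)
  obtain r \<mu> where r: "strict_mono r" and \<mu>: "prob_space \<mu>" "sets \<mu> = sets borel" "emeasure \<mu> (- {0..1}) = 0"
    and lim: "\<And>i. (\<lambda>k. measure_pmf.expectation (q (r k)) (\<lambda>x. x ^ i)) \<longlonglongrightarrow> (\<integral>x. x ^ i \<partial>\<mu>)"
    using pmf_moments_convergent_subseq[of q] q(1) by (auto simp: P_def)
  define m where "m i = (\<integral>x. x ^ i \<partial>\<mu>)" for i
  define a where "a i = \<nu> $ i - m i" for i
  have lim_E: "(\<lambda>k. E (q (r k)) i) \<longlonglongrightarrow> m i" for i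
    unfolding E_def m_def by (rule lim)
  have "(\<lambda>k. D (q (r k))) \<longlonglongrightarrow> (\<Sum>i\<le>N. (a i)\<^sup>2)"
    unfolding D_def a_def by (intro tendsto_intros lim_E)
  then have d: "d = (\<Sum>i\<le>N. (a i)\<^sup>2)"
    using LIMSEQ_unique LIMSEQ_subseq_LIMSEQ[OF \<open>(\<lambda>k. D (q k)) \<longlonglongrightarrow> d\<close> r]
    by (auto simp: o_def)
  have variation: "(\<Sum>i\<le>N. a i * (x ^ i - m i)) \<le> 0" if x: "x \<in> {0..1}" for x
  proof (rule first_variation)
    fix t :: real assume t: "0 < t" "t \<le> 1"
    define mix where "mix p = bernoulli_pmf t \<bind> (\<lambda>b. if b then return_pmf x else p)" for p
    have E_mix: "E (mix p) i = t * x ^ i + (1 - t) * E p i" if "p \<in> P" for p i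
      unfolding E_def mix_def
      by (subst pmf_expectation_bind[of UNIV]) (use that t in \<open>auto simp: UNIV_bool P_def\<close>)
    have "mix p \<in> P" if "p \<in> P" for p
      using that x by (auto simp: P_def mix_def split: if_splits)
    then have "d \<le> (\<Sum>i\<le>N. (\<nu> $ i - (t * x ^ i + (1 - t) * E (q (r k)) i))\<^sup>2)" for k
      using lower[of "mix (q (r k))"] q(1)[of "r k"] by (simp add: D_def E_mix)
    moreover have "(\<lambda>k. \<Sum>i\<le>N. (\<nu> $ i - (t * x ^ i + (1 - t) * E (q (r k)) i))\<^sup>2)
        \<longlonglongrightarrow> (\<Sum>i\<le>N. (\<nu> $ i - (t * x ^ i + (1 - t) * m i))\<^sup>2)"
      by (intro tendsto_intros lim_E)
    ultimately have "d \<le> (\<Sum>i\<le>N. (\<nu> $ i - (t * x ^ i + (1 - t) * m i))\<^sup>2)"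
      using LIMSEQ_le_const by blast
    also have "\<dots> = (\<Sum>i\<le>N. (a i - t * (x ^ i - m i))\<^sup>2)"
      by (intro sum.cong refl arg_cong[of _ _ "\<lambda>z. z\<^sup>2"]) (simp add: a_def algebra_simps)
    finally show "(\<Sum>i\<le>N. (a i)\<^sup>2) \<le> (\<Sum>i\<le>N. (a i - t * (x ^ i - m i))\<^sup>2)"
      using d by simp
  qed
  define f where "f = (\<Sum>i\<le>N. [:a i * m i:] - monom (a i) i)"
  have "poly f x = - (\<Sum>i\<le>N. a i * (x ^ i - m i))" for x
    by (simp add: f_def poly_sum poly_monom sum_negf[symmetric] algebra_simps)
  then have "f \<in> nonneg_polys"
    using variation by (simp add: nonneg_polys_def)
  moreover have "degree f \<le> N"
    unfolding f_def
    by (intro degree_sum_le degree_diff_le) (auto intro: order.trans[OF degree_monom_le])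
  ultimately have "0 \<le> riesz (\<lambda>i. \<nu> $ i) f"
    by (rule nonneg)
  also have "riesz (\<lambda>i. \<nu> $ i) f = - (\<Sum>i\<le>N. (a i)\<^sup>2)"
    using \<nu>(2) by (simp add: f_def riesz_sum riesz_diff riesz_monom sum_negf[symmetric] flip: monom_0)
      (simp add: a_def power2_eq_square algebra_simps)
  finally have "(\<Sum>i\<le>N. (a i)\<^sup>2) = 0"
    using sum_nonneg[of "{..N}" "\<lambda>i. (a i)\<^sup>2"] by simp
  then have "\<forall>i\<le>N. \<nu> $ i = m i"
    by (subst (asm) sum_nonneg_eq_0_iff) (auto simp: a_def)
  then have "\<nu> = vec (N + 1) (\<lambda>i. \<integral>x. x ^ i \<partial>\<mu>)"
    using \<nu>(1) by (intro eq_vecI) (auto simp: m_def)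
  then show ?thesis
    using \<mu> prob_space.finite_measure by (auto simp: moment_space_def)
qed

section \<open>Hankel matrices as forms on polynomials\<close>

definition vec_poly :: "real vec \<Rightarrow> real poly" where
  "vec_poly u = (\<Sum>i<dim_vec u. monom (u $ i) i)"

lemma coeff_vec_poly: "coeff (vec_poly u) i = (if i < dim_vec u then u $ i else 0)"
  by (simp add: vec_poly_def coeff_sum)

lemma degree_vec_poly:
  assumes "u \<in> carrier_vec (n + 1)"
  shows "degree (vec_poly u) \<le> n"
  using assms by (intro degree_le) (auto simp: coeff_vec_poly)

lemma vec_poly_coeffs:
  assumes "degree p < k"
  shows "vec_poly (vec k (coeff p)) = p"
  using assms by (intro poly_eqI) (auto simp: coeff_vec_poly coeff_eq_0)

lemma vec_poly_inj:
  assumes "u \<in> carrier_vec k" "w \<in> carrier_vec k" "vec_poly u = vec_poly w"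
  shows "u = w"
proof (rule eq_vecI)
  fix i assume "i < dim_vec w"
  then show "u $ i = w $ i"
    using arg_cong[OF assms(3), of "\<lambda>p. coeff p i"] assms(1,2) by (simp add: coeff_vec_poly)
qed (use assms in auto)

lemma poly_vec_poly: "poly (vec_poly u) x = u \<bullet> vec (dim_vec u) (\<lambda>i. x ^ i)"
  by (simp add: vec_poly_def poly_sum poly_monom scalar_prod_def atLeast0LessThan)

lemma bilinear_form_sum:
  fixes M :: "real mat"
  assumes "M \<in> carrier_mat k k" "u \<in> carrier_vec k" "w \<in> carrier_vec k"
  shows "u \<bullet> (M *\<^sub>v w) = (\<Sum>i<k. \<Sum>j<k. M $$ (i, j) * (u $ i * w $ j))"
  using assms by (simp add: scalar_prod_def atLeast0LessThan sum_distrib_left mult_ac)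

text \<open>The entry of \<open>hankel y\<close> at \<open>(i, j)\<close> is the value of the functional at the product of the monomials of
  orders \<open>i\<close> and \<open>j\<close>.\<close>
lemma bilinear_hankel:
  assumes "y \<in> carrier_vec (2 * n + 1)" "u \<in> carrier_vec (n + 1)" "w \<in> carrier_vec (n + 1)"
  shows "u \<bullet> (hankel y *\<^sub>v w) = riesz (\<lambda>i. y $ i) (vec_poly u * vec_poly w)"
proof -
  have H: "hankel y \<in> carrier_mat (n + 1) (n + 1)"
    using assms(1) by (simp add: hankel_def Let_def)
  have "u \<bullet> (hankel y *\<^sub>v w) = (\<Sum>i<n+1. \<Sum>j<n+1. y $ (i + j) * (u $ i * w $ j))"
    unfolding bilinear_form_sum[OF H assms(2,3)]
    using assms(1) by (intro sum.cong) (auto simp: hankel_def Let_def)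
  also have "\<dots> = riesz (\<lambda>i. y $ i) (\<Sum>i<n+1. \<Sum>j<n+1. monom (u $ i * w $ j) (i + j))"
    by (simp only: riesz_sum riesz_monom) (simp add: mult_ac)
  also have "(\<Sum>i<n+1. \<Sum>j<n+1. monom (u $ i * w $ j) (i + j)) = vec_poly u * vec_poly w"
    using assms by (simp only: vec_poly_def sum_product mult_monom carrier_vecD)
  finally show ?thesis .
qed

text \<open>The defining property of the adjoint, tested on the moments \<open>x ^ l\<close> of a point mass, whose Hankel
  matrix has rank one.\<close>
lemma poly_hankel_adjoint:
  assumes "M \<in> carrier_mat (n + 1) (n + 1)"
  shows "poly (vec_poly (hankel_adjoint M)) x =
    vec (n + 1) (\<lambda>i. x ^ i) \<bullet> (M *\<^sub>v vec (n + 1) (\<lambda>i. x ^ i))"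
proof -
  let ?A = "\<lambda>l. {(i, j). i < n + 1 \<and> j < n + 1 \<and> i + j = l}"
  have finite: "finite (?A l)" for l
    by (rule finite_subset[of _ "{..<n+1} \<times> {..<n+1}"]) auto
  have "poly (vec_poly (hankel_adjoint M)) x =
      (\<Sum>l<2*n+1. (\<Sum>(i, j)\<in>?A l. M $$ (i, j)) * x ^ l)"
    using assms by (simp add: vec_poly_def hankel_adjoint_def Let_def poly_sum poly_monom)
  also have "\<dots> = (\<Sum>l<2*n+1. \<Sum>(i, j)\<in>?A l. M $$ (i, j) * (x ^ i * x ^ j))"
    by (intro sum.cong refl) (auto simp: sum_distrib_right power_add intro!: sum.cong)
  also have "\<dots> = (\<Sum>(i, j)\<in>(\<Union>l<2*n+1. ?A l). M $$ (i, j) * (x ^ i * x ^ j))"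
    by (subst sum.UNION_disjoint) (use finite in auto)
  also have "(\<Union>l<2*n+1. ?A l) = {..<n+1} \<times> {..<n+1}"
    by auto
  also have "(\<Sum>(i, j)\<in>{..<n+1} \<times> {..<n+1}. M $$ (i, j) * (x ^ i * x ^ j)) =
      (\<Sum>i<n+1. \<Sum>j<n+1. M $$ (i, j) * (x ^ i * x ^ j))"
    by (simp only: sum.cartesian_product)
  also have "\<dots> = vec (n + 1) (\<lambda>i. x ^ i) \<bullet> (M *\<^sub>v vec (n + 1) (\<lambda>i. x ^ i))"
    by (subst bilinear_form_sum[OF assms]) auto
  finally show ?thesis .
qed

section \<open>The shift matrices and the two weighted matrices\<close>

lemma L1_eq: "L1 n = mat (n + 1) n (\<lambda>(i, j). if i = j then 1 else 0)"
  by (intro eq_matI) (auto simp: L1_def append_rows_def)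

lemma L2_eq: "L2 n = mat (n + 1) n (\<lambda>(i, j). if i = j + 1 then 1 else 0)"
  by (intro eq_matI) (auto simp: L2_def append_rows_def)

lemma L1_carrier [simp]: "L1 n \<in> carrier_mat (n + 1) n"
  by (simp add: L1_eq)

lemma L2_carrier [simp]: "L2 n \<in> carrier_mat (n + 1) n"
  by (simp add: L2_eq)

text \<open>On coefficient vectors \<open>L1\<close> is the inclusion into polynomials of higher degree, \<open>L2\<close> is multiplication
  by the variable; on vectors of powers of \<open>x\<close> their transposes are truncation and truncation
  followed by multiplication with \<open>x\<close>. This is how the combination of \<open>L1\<close> and \<open>L2\<close> in both matrix
  constraints encodes the weight \<open>x * (1 - x)\<close>.\<close>
lemma L1_mult_coeffs:
  assumes "degree p < n"
  shows "L1 n *\<^sub>v vec n (coeff p) = vec (n + 1) (coeff p)"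
  using assms by (intro eq_vecI)
    (auto simp: L1_eq scalar_prod_def if_distribR if_distrib coeff_eq_0 cong: if_cong)

lemma L2_mult_coeffs:
  "L2 n *\<^sub>v vec n (coeff p) = vec (n + 1) (coeff ([:0, 1:] * p))"
proof (intro eq_vecI)
  fix i assume "i < dim_vec (vec (n + 1) (coeff ([:0, 1:] * p)))"
  then show "(L2 n *\<^sub>v vec n (coeff p)) $ i = vec (n + 1) (coeff ([:0, 1:] * p)) $ i"
    by (cases i) (auto simp: L2_eq scalar_prod_def if_distribR if_distrib cong: if_cong)
qed (simp add: L2_eq)

lemma L1_transpose_powers:
  "transpose_mat (L1 n) *\<^sub>v vec (n + 1) (\<lambda>i. x ^ i) = vec n (\<lambda>i. x ^ i :: real)"
  by (intro eq_vecI) (auto simp: L1_eq scalar_prod_def if_distribR if_distrib cong: if_cong)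

lemma L2_transpose_powers:
  "transpose_mat (L2 n) *\<^sub>v vec (n + 1) (\<lambda>i. x ^ i) = x \<cdot>\<^sub>v vec n (\<lambda>i. x ^ i :: real)"
  by (intro eq_vecI) (auto simp: L2_eq scalar_prod_def if_distribR if_distrib cong: if_cong)

lemma symmetric_hankel:
  assumes "y \<in> carrier_vec (2 * n + 1)"
  shows "symmetric_mat (n + 1) (hankel y)"
  using assms by (auto simp: symmetric_mat_def hankel_def Let_def add.commute intro!: eq_matI)

lemma psd_iff:
  assumes "symmetric_mat k M"
  shows "psd M \<longleftrightarrow> (\<forall>u\<in>carrier_vec k. 0 \<le> u \<bullet> (M *\<^sub>v u))"
  using assms by (auto simp: psd_def symmetric_mat_def)

lemma congruence_form:
  fixes M :: "real mat"
  assumes "C \<in> carrier_mat a b" "D \<in> carrier_mat a b" "M \<in> carrier_mat a a" "u \<in> carrier_vec b"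
  shows "u \<bullet> (transpose_mat C * M * D *\<^sub>v u) = (C *\<^sub>v u) \<bullet> (M *\<^sub>v (D *\<^sub>v u))"
proof -
  have "transpose_mat C * M * D *\<^sub>v u = transpose_mat C *\<^sub>v (M *\<^sub>v (D *\<^sub>v u))"
    using assms by (subst assoc_mult_mat_vec[of _ b a _ b], auto)+
  moreover have "u \<bullet> (transpose_mat C *\<^sub>v (M *\<^sub>v (D *\<^sub>v u))) = (C *\<^sub>v u) \<bullet> (M *\<^sub>v (D *\<^sub>v u))"
    using transpose_vec_mult_scalar[of "transpose_mat C" b a "M *\<^sub>v (D *\<^sub>v u)" u] assms by simp
  ultimately show ?thesis by simp
qed

text \<open>The next two matrices combine \<open>L1\<close> and \<open>L2\<close> in the same way on dual sides: the first turns a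
  Hankel matrix into the Gram matrix of the products weighted with \<open>x * (1 - x)\<close>, the second merges the
  matrix of a sum of squares and that of a sum of weighted squares.\<close>
definition localizing :: "nat \<Rightarrow> real mat \<Rightarrow> real mat" where
  "localizing n H = (1/2) \<cdot>\<^sub>m (transpose_mat (L1 n) * H * L2 n + transpose_mat (L2 n) * H * L1 n)
     - transpose_mat (L2 n) * H * L2 n"

definition gram_mat :: "nat \<Rightarrow> real mat \<Rightarrow> real mat \<Rightarrow> real mat" where
  "gram_mat n Z W = Z + (1/2) \<cdot>\<^sub>m (L1 n * W * transpose_mat (L2 n) + L2 n * W * transpose_mat (L1 n))
     - L2 n * W * transpose_mat (L2 n)"

lemma transpose_half_sum_minus:
  fixes P Q R :: "real mat"
  assumes "P \<in> carrier_mat k k" "Q \<in> carrier_mat k k" "R \<in> carrier_mat k k"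
  shows "transpose_mat ((1/2) \<cdot>\<^sub>m (P + Q) - R) =
    (1/2) \<cdot>\<^sub>m (transpose_mat P + transpose_mat Q) - transpose_mat R"
  using assms by (intro eq_matI) auto

lemma symmetric_localizing:
  assumes "symmetric_mat (n + 1) H"
  shows "symmetric_mat n (localizing n H)"
proof -
  have H: "H \<in> carrier_mat (n + 1) (n + 1)" "transpose_mat H = H"
    using assms by (auto simp: symmetric_mat_def)
  have tr: "transpose_mat (transpose_mat C * H * D) = transpose_mat D * H * C"
    if "C \<in> carrier_mat (n + 1) n" "D \<in> carrier_mat (n + 1) n" for C D
  proof -
    have C: "transpose_mat C \<in> carrier_mat n (n + 1)" and D: "transpose_mat D \<in> carrier_mat n (n + 1)"
      using that by auto
    have "transpose_mat (transpose_mat C * H * D) = transpose_mat D * (H * C)"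
      by (simp only: transpose_mult[OF mult_carrier_mat[OF C H(1)] that(2)] transpose_mult[OF C H(1)]
          H(2) transpose_transpose)
    then show ?thesis
      by (simp only: assoc_mult_mat[OF D H(1) that(1)])
  qed
  have c: "transpose_mat C * H * D \<in> carrier_mat n n"
    if "C \<in> carrier_mat (n + 1) n" "D \<in> carrier_mat (n + 1) n" for C D
    using that H by (intro mult_carrier_mat[of _ n "n + 1"]) auto
  note L = L1_carrier L2_carrier
  have "transpose_mat (localizing n H) = localizing n H"
    unfolding localizing_def transpose_half_sum_minus[OF c[OF L(1,2)] c[OF L(2,1)] c[OF L(2,2)]]
    by (simp only: tr L comm_add_mat[OF c[OF L(2,1)] c[OF L(1,2)]])
  moreover have "localizing n H \<in> carrier_mat n n"
    unfolding localizing_def by (intro minus_carrier_mat c L)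
  ultimately show ?thesis by (simp add: symmetric_mat_def)
qed

lemma form_add:
  fixes M :: "real mat"
  assumes "M \<in> carrier_mat k k" "N \<in> carrier_mat k k" "u \<in> carrier_vec k"
  shows "u \<bullet> ((M + N) *\<^sub>v u) = u \<bullet> (M *\<^sub>v u) + u \<bullet> (N *\<^sub>v u)"
  using assms mult_mat_vec_carrier[of M k k u] mult_mat_vec_carrier[of N k k u]
  by (simp add: add_mult_distrib_mat_vec[of _ k k] scalar_prod_add_distrib[of _ k])

lemma form_minus:
  fixes M :: "real mat"
  assumes "M \<in> carrier_mat k k" "N \<in> carrier_mat k k" "u \<in> carrier_vec k"
  shows "u \<bullet> ((M - N) *\<^sub>v u) = u \<bullet> (M *\<^sub>v u) - u \<bullet> (N *\<^sub>v u)"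
  using assms mult_mat_vec_carrier[of M k k u] mult_mat_vec_carrier[of N k k u]
  by (simp add: minus_mult_distrib_mat_vec[of _ k k] scalar_prod_minus_distrib[of _ k])

lemma form_smult:
  fixes M :: "real mat"
  assumes "M \<in> carrier_mat k k" "u \<in> carrier_vec k"
  shows "u \<bullet> ((c \<cdot>\<^sub>m M) *\<^sub>v u) = c * (u \<bullet> (M *\<^sub>v u))"
  using assms by (simp add: bilinear_form_sum[of _ k] sum_distrib_left mult_ac)

lemma form_zero:
  "u \<in> carrier_vec k \<Longrightarrow> u \<bullet> (0\<^sub>m k k *\<^sub>v u) = (0 :: real)"
  by (simp add: bilinear_form_sum[of _ k])

lemma form_half_sum_minus:
  fixes P Q R :: "real mat"
  assumes "P \<in> carrier_mat k k" "Q \<in> carrier_mat k k" "R \<in> carrier_mat k k" "u \<in> carrier_vec k"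
  shows "u \<bullet> (((1/2) \<cdot>\<^sub>m (P + Q) - R) *\<^sub>v u) =
    1/2 * (u \<bullet> (P *\<^sub>v u) + u \<bullet> (Q *\<^sub>v u)) - u \<bullet> (R *\<^sub>v u)"
  using assms by (simp add: form_minus[of _ k] form_smult[of _ k] form_add[of _ k])

text \<open>Here \<open>L1\<close> and \<open>L2\<close> turn \<open>p\<close> into \<open>p\<close> and \<open>X * p\<close>, and the three terms of the localizing matrix add up to
  \<open>X * p\<^sup>2 - X\<^sup>2 * p\<^sup>2\<close>.\<close>
lemma form_localizing_hankel:
  assumes "y \<in> carrier_vec (2 * n + 1)" "degree p < n"
  shows "vec n (coeff p) \<bullet> (localizing n (hankel y) *\<^sub>v vec n (coeff p)) =
    riesz (\<lambda>i. y $ i) ([:0, 1, -1:] * p\<^sup>2)"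
proof -
  let ?u = "vec n (coeff p)" and ?X = "[:0, 1 :: real:]" and ?L = "riesz (\<lambda>i. y $ i)"
  have H: "hankel y \<in> carrier_mat (n + 1) (n + 1)"
    using symmetric_hankel[OF assms(1)] by (simp add: symmetric_mat_def)
  have c: "transpose_mat C * hankel y * D \<in> carrier_mat n n"
    if "C \<in> carrier_mat (n + 1) n" "D \<in> carrier_mat (n + 1) n" for C D
    using that H by (intro mult_carrier_mat[of _ n "n + 1"]) auto
  have deg: "degree (?X * p) < n + 1" "degree p < n + 1"
    using assms(2) degree_mult_le[of ?X p] by auto
  have b: "vec (n + 1) (coeff f) \<bullet> (hankel y *\<^sub>v vec (n + 1) (coeff g)) = ?L (f * g)"
    if "degree f < n + 1" "degree g < n + 1" for f g
    using bilinear_hankel[OF assms(1)] vec_poly_coeffs that by simp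
  have form: "?u \<bullet> (transpose_mat C * hankel y * D *\<^sub>v ?u) = ?L (f * g)"
    if "C \<in> carrier_mat (n + 1) n" "D \<in> carrier_mat (n + 1) n"
      "C *\<^sub>v ?u = vec (n + 1) (coeff f)" "D *\<^sub>v ?u = vec (n + 1) (coeff g)"
      "degree f < n + 1" "degree g < n + 1" for C D f g
    using congruence_form[OF that(1,2) H vec_carrier] b[OF that(5,6)] that(3,4) by simp
  note L = L1_carrier L2_carrier L1_mult_coeffs[OF assms(2)] L2_mult_coeffs
  have "?u \<bullet> (localizing n (hankel y) *\<^sub>v ?u) =
      1/2 * (?L (p * (?X * p)) + ?L ((?X * p) * p)) - ?L ((?X * p) * (?X * p))"
    unfolding localizing_def
    by (subst form_half_sum_minus[of _ n])
      (simp_all only: c L vec_carrier form[OF L(1,2,3,4) deg(2,1)] form[OF L(2,1,4,3) deg]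
        form[OF L(2,2,4,4) deg(1,1)])
  also have "\<dots> = ?L (Polynomial.smult (1/2) (p * (?X * p) + (?X * p) * p) - (?X * p) * (?X * p))"
    by (simp only: riesz_diff riesz_smult riesz_add)
  also have "Polynomial.smult (1/2) (p * (?X * p) + (?X * p) * p) - (?X * p) * (?X * p) = [:0, 1, -1:] * p\<^sup>2"
    by (rule poly_ext) (simp add: power2_eq_square algebra_simps)
  finally show ?thesis .
qed

lemma vec_coeff_vec_poly:
  "u \<in> carrier_vec k \<Longrightarrow> vec k (coeff (vec_poly u)) = u"
  by (intro eq_vecI) (auto simp: coeff_vec_poly)

lemma degree_vec_poly_less:
  "u \<in> carrier_vec n \<Longrightarrow> 0 < n \<Longrightarrow> degree (vec_poly u) < n"
  using degree_vec_poly[of u "n - 1"] by simp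

lemma psd_hankel_iff:
  assumes "y \<in> carrier_vec (2 * n + 1)"
  shows "psd (hankel y) \<longleftrightarrow> (\<forall>p. degree p \<le> n \<longrightarrow> 0 \<le> riesz (\<lambda>i. y $ i) (p\<^sup>2))"
proof -
  have "u \<bullet> (hankel y *\<^sub>v u) = riesz (\<lambda>i. y $ i) ((vec_poly u)\<^sup>2)" if "u \<in> carrier_vec (n + 1)" for u
    using bilinear_hankel[OF assms that that] by (simp add: power2_eq_square)
  then show ?thesis
    unfolding psd_iff[OF symmetric_hankel[OF assms]]
    by (metis degree_vec_poly less_Suc_eq_le vec_poly_coeffs vec_carrier Suc_eq_plus1)
qed

lemma psd_localizing_hankel_iff:
  assumes "y \<in> carrier_vec (2 * n + 1)" "0 < n"
  shows "psd (localizing n (hankel y)) \<longleftrightarrow>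
    (\<forall>p. degree p < n \<longrightarrow> 0 \<le> riesz (\<lambda>i. y $ i) ([:0, 1, -1:] * p\<^sup>2))"
  unfolding psd_iff[OF symmetric_localizing[OF symmetric_hankel[OF assms(1)]]]
  using form_localizing_hankel[OF assms(1)] vec_coeff_vec_poly degree_vec_poly_less[OF _ assms(2)]
  by (metis vec_carrier)

text \<open>The moment half of the equivalence, dual to the polynomial half: by the Lukacs representation the two
  matrix inequalities say that the functional of \<open>y\<close> is nonnegative on the nonnegative polynomials.\<close>
theorem moment_space_iff_psd:
  assumes "y \<in> carrier_vec (2 * n + 1)" "y $ 0 = 1" "0 < n"
  shows "y \<in> moment_space (2 * n) \<longleftrightarrow> psd (hankel y) \<and> psd (localizing n (hankel y))"
proof
  assume y: "y \<in> moment_space (2 * n)"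
  have "p\<^sup>2 \<in> nonneg_polys" "degree (p\<^sup>2) \<le> 2 * n" if "degree p \<le> n" for p
    using that degree_power_le[of p 2] by (auto simp: nonneg_polys_def)
  moreover have "[:0, 1, -1:] * p\<^sup>2 \<in> nonneg_polys" "degree ([:0, 1, -1:] * p\<^sup>2) \<le> 2 * n"
    if "degree p < n" for p
  proof -
    have eq: "poly ([:0, 1, -1:] * p\<^sup>2) x = x * (1 - x) * (poly p x)\<^sup>2" for x
      by (simp add: algebra_simps)
    show "[:0, 1, -1:] * p\<^sup>2 \<in> nonneg_polys"
      unfolding nonneg_polys_def mem_Collect_eq eq by (intro ballI mult_nonneg_nonneg) auto
    show "degree ([:0, 1, -1:] * p\<^sup>2) \<le> 2 * n"
      using that degree_power_le[of p 2] degree_mult_le[of "[:0, 1, -1:]" "p\<^sup>2"] by auto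
  qed
  ultimately show "psd (hankel y) \<and> psd (localizing n (hankel y))"
    unfolding psd_hankel_iff[OF assms(1)] psd_localizing_hankel_iff[OF assms(1,3)]
    using moment_space_riesz_nonneg[OF y] by blast
next
  assume "psd (hankel y) \<and> psd (localizing n (hankel y))"
  then show "y \<in> moment_space (2 * n)"
    unfolding psd_hankel_iff[OF assms(1)] psd_localizing_hankel_iff[OF assms(1,3)]
    using assms(1,2) by (intro moment_space_of_riesz_nonneg)
      (auto intro: riesz_nonneg_of_lukacs_cone[OF lukacs])
qed

lemma add_diff_assoc_mat:
  fixes P Q R :: "real mat"
  assumes "P \<in> carrier_mat k k" "Q \<in> carrier_mat k k" "R \<in> carrier_mat k k"
  shows "P + Q - R = P + (Q - R)"
  using assms by (intro eq_matI) auto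

lemma gram_mat_carrier:
  assumes "Z \<in> carrier_mat (n + 1) (n + 1)" "W \<in> carrier_mat n n"
  shows "gram_mat n Z W \<in> carrier_mat (n + 1) (n + 1)"
proof -
  have "C * W * transpose_mat D \<in> carrier_mat (n + 1) (n + 1)"
    if "C \<in> carrier_mat (n + 1) n" "D \<in> carrier_mat (n + 1) n" for C D
    using that assms by (intro mult_carrier_mat[of _ "n + 1" n]) auto
  then show ?thesis
    unfolding gram_mat_def by (intro minus_carrier_mat) (simp only: L2_carrier)
qed

lemma poly_hankel_adjoint_gram_mat:
  assumes "Z \<in> carrier_mat (n + 1) (n + 1)" "W \<in> carrier_mat n n"
  shows "poly (vec_poly (hankel_adjoint (gram_mat n Z W))) x =
    vec (n + 1) (\<lambda>i. x ^ i) \<bullet> (Z *\<^sub>v vec (n + 1) (\<lambda>i. x ^ i)) +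
    x * (1 - x) * (vec n (\<lambda>i. x ^ i) \<bullet> (W *\<^sub>v vec n (\<lambda>i. x ^ i)))"
proof -
  let ?u = "vec (n + 1) (\<lambda>i. x ^ i)" and ?w = "vec n (\<lambda>i. x ^ i)"
  have c: "C * W * transpose_mat D \<in> carrier_mat (n + 1) (n + 1)"
    if "C \<in> carrier_mat (n + 1) n" "D \<in> carrier_mat (n + 1) n" for C D
    using that assms by (intro mult_carrier_mat[of _ "n + 1" n]) auto
  have f: "?u \<bullet> (C * W * transpose_mat D *\<^sub>v ?u) =
      (transpose_mat C *\<^sub>v ?u) \<bullet> (W *\<^sub>v (transpose_mat D *\<^sub>v ?u))"
    if "C \<in> carrier_mat (n + 1) n" "D \<in> carrier_mat (n + 1) n" for C D
    using congruence_form[of "transpose_mat C" n "n + 1" "transpose_mat D" W ?u] that assms by simp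
  have W: "(a \<cdot>\<^sub>v ?w) \<bullet> (W *\<^sub>v (b \<cdot>\<^sub>v ?w)) = a * b * (?w \<bullet> (W *\<^sub>v ?w))" for a b
    using assms(2) by (simp add: bilinear_form_sum[of _ n] sum_distrib_left mult_ac)
  note L = L1_carrier L2_carrier
  have "gram_mat n Z W = Z + ((1/2) \<cdot>\<^sub>m (L1 n * W * transpose_mat (L2 n) + L2 n * W * transpose_mat (L1 n))
      - L2 n * W * transpose_mat (L2 n))" (is "_ = _ + ?V")
    unfolding gram_mat_def
    by (rule add_diff_assoc_mat[OF assms(1) _ c[OF L(2,2)]])
      (intro smult_carrier_mat add_carrier_mat c L)
  moreover have "?V \<in> carrier_mat (n + 1) (n + 1)"
    by (intro minus_carrier_mat c L)
  ultimately have "?u \<bullet> (gram_mat n Z W *\<^sub>v ?u) = ?u \<bullet> (Z *\<^sub>v ?u) + ?u \<bullet> (?V *\<^sub>v ?u)"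
    using form_add[OF assms(1) _ vec_carrier] by simp
  also have "?u \<bullet> (?V *\<^sub>v ?u) =
      1/2 * (?w \<bullet> (W *\<^sub>v (x \<cdot>\<^sub>v ?w)) + (x \<cdot>\<^sub>v ?w) \<bullet> (W *\<^sub>v ?w)) - (x \<cdot>\<^sub>v ?w) \<bullet> (W *\<^sub>v (x \<cdot>\<^sub>v ?w))"
    by (subst form_half_sum_minus[of _ "n + 1"])
      (simp_all only: c L vec_carrier f L1_transpose_powers L2_transpose_powers)
  also have "?u \<bullet> (Z *\<^sub>v ?u) + (1/2 * (?w \<bullet> (W *\<^sub>v (x \<cdot>\<^sub>v ?w)) + (x \<cdot>\<^sub>v ?w) \<bullet> (W *\<^sub>v ?w))
      - (x \<cdot>\<^sub>v ?w) \<bullet> (W *\<^sub>v (x \<cdot>\<^sub>v ?w))) = ?u \<bullet> (Z *\<^sub>v ?u) + x * (1 - x) * (?w \<bullet> (W *\<^sub>v ?w))"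
    using W[of 1 x] W[of x 1] W[of x x] by (simp add: algebra_simps)
  finally show ?thesis
    by (simp only: poly_hankel_adjoint[OF gram_mat_carrier[OF assms]])
qed

lemma hankel_adjoint_gram_mat_eq_iff:
  assumes "Z \<in> carrier_mat (n + 1) (n + 1)" "W \<in> carrier_mat n n" "degree f \<le> 2 * n"
  shows "hankel_adjoint (gram_mat n Z W) = vec (2 * n + 1) (coeff f) \<longleftrightarrow>
    (\<forall>x. poly f x = vec (n + 1) (\<lambda>i. x ^ i) \<bullet> (Z *\<^sub>v vec (n + 1) (\<lambda>i. x ^ i)) +
      x * (1 - x) * (vec n (\<lambda>i. x ^ i) \<bullet> (W *\<^sub>v vec n (\<lambda>i. x ^ i))))"
proof -
  have "hankel_adjoint (gram_mat n Z W) \<in> carrier_vec (2 * n + 1)"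
    using gram_mat_carrier[OF assms(1,2)] by (simp add: hankel_adjoint_def Let_def)
  then have "hankel_adjoint (gram_mat n Z W) = vec (2 * n + 1) (coeff f) \<longleftrightarrow>
      vec_poly (hankel_adjoint (gram_mat n Z W)) = vec_poly (vec (2 * n + 1) (coeff f))"
    using vec_poly_inj[OF _ vec_carrier] by metis
  also have "\<dots> \<longleftrightarrow> vec_poly (hankel_adjoint (gram_mat n Z W)) = f"
    using assms(3) by (subst vec_poly_coeffs) auto
  finally show ?thesis
    using poly_hankel_adjoint_gram_mat[OF assms(1,2)] by (metis poly_ext)
qed

section \<open>Gram matrices of nonnegative polynomials\<close>

lemma psd_zero: "psd (0\<^sub>m k k)"
  by (auto simp: psd_def symmetric_mat_def form_zero)

lemma psd_add:
  assumes "psd M" "psd N" "M \<in> carrier_mat k k" "N \<in> carrier_mat k k"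
  shows "psd (M + N)"
  using assms by (auto simp: psd_def symmetric_mat_def form_add[of _ k] transpose_add[of _ k k])

definition outer :: "real vec \<Rightarrow> real mat" where
  "outer u = mat (dim_vec u) (dim_vec u) (\<lambda>(i, j). u $ i * u $ j)"

lemma form_outer:
  assumes "w \<in> carrier_vec (dim_vec u)"
  shows "w \<bullet> (outer u *\<^sub>v w) = (u \<bullet> w)\<^sup>2"
proof -
  have "w \<bullet> (outer u *\<^sub>v w) = (\<Sum>i<dim_vec u. \<Sum>j<dim_vec u. (u $ i * w $ i) * (u $ j * w $ j))"
    using assms by (subst bilinear_form_sum[of _ "dim_vec u"]) (auto simp: outer_def mult_ac intro!: sum.cong)
  then show ?thesis
    using assms by (simp add: scalar_prod_def power2_eq_square sum_product atLeast0LessThan)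
qed

lemma psd_outer: "psd (outer u)"
  unfolding psd_def using form_outer[of _ u]
  by (auto simp: symmetric_mat_def outer_def mult.commute intro!: eq_matI)

lemma form_outer_coeffs:
  assumes "degree p < k"
  shows "vec k (\<lambda>i. x ^ i) \<bullet> (outer (vec k (coeff p)) *\<^sub>v vec k (\<lambda>i. x ^ i)) = (poly p x)\<^sup>2"
  using form_outer[of "vec k (\<lambda>i. x ^ i)" "vec k (coeff p)"]
    poly_vec_poly[of "vec k (coeff p)" x] vec_poly_coeffs[OF assms] by simp

text \<open>A square \<open>p\<^sup>2\<close> is represented by the rank-one matrix of the coefficient vector of \<open>p\<close>, and sums of
  polynomials by sums of matrices.\<close>
lemma lukacs_cone_gram:
  assumes "lukacs_cone n f"
  shows "\<exists>Z\<in>carrier_mat (n + 1) (n + 1). \<exists>W\<in>carrier_mat n n. psd Z \<and> psd W \<and>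
    (\<forall>x. poly f x = vec (n + 1) (\<lambda>i. x ^ i) \<bullet> (Z *\<^sub>v vec (n + 1) (\<lambda>i. x ^ i)) +
      x * (1 - x) * (vec n (\<lambda>i. x ^ i) \<bullet> (W *\<^sub>v vec n (\<lambda>i. x ^ i))))"
  using assms
proof induction
  case (square p)
  have "outer (vec (n + 1) (coeff p)) \<in> carrier_mat (n + 1) (n + 1)" by (simp add: outer_def)
  then show ?case
    using square form_outer_coeffs[of p "n + 1"] psd_outer psd_zero
    by (intro bexI[of _ "outer (vec (n + 1) (coeff p))"] bexI[of _ "0\<^sub>m n n"]) (auto simp: form_zero)
next
  case (weighted_square p)
  have "outer (vec n (coeff p)) \<in> carrier_mat n n" by (simp add: outer_def)
  then show ?case
    using weighted_square form_outer_coeffs[of p n] psd_outer psd_zero[of "n + 1"]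
    by (intro bexI[of _ "0\<^sub>m (n + 1) (n + 1)"] bexI[of _ "outer (vec n (coeff p))"])
      (auto simp: form_zero algebra_simps)
next
  case (sum f g)
  obtain Z W Z' W' where
    Z: "Z \<in> carrier_mat (n + 1) (n + 1)" "Z' \<in> carrier_mat (n + 1) (n + 1)" "psd Z" "psd Z'" and
    W: "W \<in> carrier_mat n n" "W' \<in> carrier_mat n n" "psd W" "psd W'" and
    f: "\<forall>x. poly f x = vec (n + 1) (\<lambda>i. x ^ i) \<bullet> (Z *\<^sub>v vec (n + 1) (\<lambda>i. x ^ i)) +
      x * (1 - x) * (vec n (\<lambda>i. x ^ i) \<bullet> (W *\<^sub>v vec n (\<lambda>i. x ^ i)))" and
    g: "\<forall>x. poly g x = vec (n + 1) (\<lambda>i. x ^ i) \<bullet> (Z' *\<^sub>v vec (n + 1) (\<lambda>i. x ^ i)) +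
      x * (1 - x) * (vec n (\<lambda>i. x ^ i) \<bullet> (W' *\<^sub>v vec n (\<lambda>i. x ^ i)))"
    using sum.IH by blast
  have "poly (f + g) x = vec (n + 1) (\<lambda>i. x ^ i) \<bullet> ((Z + Z') *\<^sub>v vec (n + 1) (\<lambda>i. x ^ i)) +
      x * (1 - x) * (vec n (\<lambda>i. x ^ i) \<bullet> ((W + W') *\<^sub>v vec n (\<lambda>i. x ^ i)))" for x
    using f g Z W by (simp only: form_add[of _ "n + 1"] form_add[of _ n] vec_carrier poly_add distrib_left)
  moreover have "Z + Z' \<in> carrier_mat (n + 1) (n + 1)" "W + W' \<in> carrier_mat n n"
    "psd (Z + Z')" "psd (W + W')"
    using Z W psd_add[of Z Z' "n + 1"] psd_add[of W W' n] by auto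
  ultimately show ?case by blast
qed

text \<open>Read as an identity of values at all \<open>x\<close>, the linear equation says that \<open>f x\<close> is the form of \<open>Z\<close> plus
  \<open>x * (1 - x)\<close> times the form of \<open>W\<close>, which is nonnegative on \<open>[0, 1]\<close>. The Lukacs theorem gives the
  converse.\<close>
theorem nonneg_polys_iff_gram:
  assumes "degree f \<le> 2 * n"
  shows "f \<in> nonneg_polys \<longleftrightarrow>
    (\<exists>Z W. symmetric_mat (n + 1) Z \<and> symmetric_mat n W \<and> psd Z \<and> psd W \<and>
      hankel_adjoint (gram_mat n Z W) = vec (2 * n + 1) (coeff f))"
proof
  assume "f \<in> nonneg_polys"
  from lukacs_cone_gram[OF lukacs[OF this assms]] obtain Z W where
    *: "Z \<in> carrier_mat (n + 1) (n + 1)" "W \<in> carrier_mat n n" "psd Z" "psd W"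
      "hankel_adjoint (gram_mat n Z W) = vec (2 * n + 1) (coeff f)"
    using hankel_adjoint_gram_mat_eq_iff[OF _ _ assms] by blast
  then have "symmetric_mat (n + 1) Z" "symmetric_mat n W"
    by (auto simp: psd_def)
  with * show "\<exists>Z W. symmetric_mat (n + 1) Z \<and> symmetric_mat n W \<and> psd Z \<and> psd W \<and>
      hankel_adjoint (gram_mat n Z W) = vec (2 * n + 1) (coeff f)"
    by blast
next
  assume "\<exists>Z W. symmetric_mat (n + 1) Z \<and> symmetric_mat n W \<and> psd Z \<and> psd W \<and>
      hankel_adjoint (gram_mat n Z W) = vec (2 * n + 1) (coeff f)"
  then obtain Z W where sym: "symmetric_mat (n + 1) Z" "symmetric_mat n W" and psd: "psd Z" "psd W"
    and eq: "hankel_adjoint (gram_mat n Z W) = vec (2 * n + 1) (coeff f)"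
    by blast
  have c: "Z \<in> carrier_mat (n + 1) (n + 1)" "W \<in> carrier_mat n n"
    using sym by (auto simp: symmetric_mat_def)
  have "0 \<le> poly f x" if "x \<in> {0..1}" for x
    using eq[unfolded hankel_adjoint_gram_mat_eq_iff[OF c assms]] that
      psd[unfolded psd_iff[OF sym(1)] psd_iff[OF sym(2)]] by simp
  then show "f \<in> nonneg_polys" by (simp add: nonneg_polys_def)
qed

section \<open>Equivalence of the two problems\<close>

lemma degree_constraint_poly:
  assumes "\<And>s'. s' < num_states G \<Longrightarrow> degree (trans G s' s) \<le> deg1 G s"
  shows "degree (constraint_poly G v \<nu> s) \<le> deg1 G s"
  unfolding constraint_poly_def
proof (intro degree_diff_le)
  show "degree (\<Sum>i\<le>deg1 G s. \<Sum>j\<le>deg2 G s. monom (reward_coeff G s i j * \<nu> s $ j) i) \<le> deg1 G s"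
    by (intro degree_sum_le) (auto intro: order.trans[OF degree_monom_le])
  show "degree (Polynomial.smult (discount G) (\<Sum>s'<num_states G. Polynomial.smult (v $ s') (trans G s' s)))
      \<le> deg1 G s"
    using assms by (intro order.trans[OF degree_smult_le] degree_sum_le) auto
qed simp

lemma coeffs_constraint_poly:
  assumes "s < num_states G" "v \<in> carrier_vec (num_states G)" "\<nu> s \<in> carrier_vec (deg2 G s + 1)"
  shows "E_mat G s *\<^sub>v v - discount G \<cdot>\<^sub>v (Q_mat G s *\<^sub>v v) - R_mat G s *\<^sub>v \<nu> s =
    vec (deg1 G s + 1) (coeff (constraint_poly G v \<nu> s))"
proof (rule eq_vecI)
  fix i assume "i < dim_vec (vec (deg1 G s + 1) (coeff (constraint_poly G v \<nu> s)))"
  then have i: "i \<le> deg1 G s" by simp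
  have E: "(E_mat G s *\<^sub>v v) $ i = coeff [:v $ s:] i"
    using i assms
    by (cases i) (auto simp: E_mat_def scalar_prod_def if_distribR if_distrib cong: if_cong)
  have Q: "(Q_mat G s *\<^sub>v v) $ i = coeff (\<Sum>s'<num_states G. Polynomial.smult (v $ s') (trans G s' s)) i"
    using i assms by (simp add: Q_mat_def scalar_prod_def coeff_sum atLeast0LessThan mult.commute)
  have "(R_mat G s *\<^sub>v \<nu> s) $ i = (\<Sum>j\<le>deg2 G s. reward_coeff G s i j * \<nu> s $ j)"
    using i assms by (simp add: R_mat_def scalar_prod_def atLeast0LessThan lessThan_Suc_atMost)
  also have "\<dots> = coeff (\<Sum>i\<le>deg1 G s. \<Sum>j\<le>deg2 G s. monom (reward_coeff G s i j * \<nu> s $ j) i) i"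
    using i by (subst sum.swap) (simp add: coeff_sum if_distrib cong: if_cong)
  finally show "(E_mat G s *\<^sub>v v - discount G \<cdot>\<^sub>v (Q_mat G s *\<^sub>v v) - R_mat G s *\<^sub>v \<nu> s) $ i =
      vec (deg1 G s + 1) (coeff (constraint_poly G v \<nu> s)) $ i"
    using i E Q by (simp add: constraint_poly_def) (simp add: E_mat_def Q_mat_def R_mat_def)
qed (simp add: R_mat_def)

lemma moment_space_carrier: "\<nu> \<in> moment_space N \<Longrightarrow> \<nu> \<in> carrier_vec (N + 1)"
  by (auto simp: moment_space_def)

text \<open>Both problems decompose into independent conditions on the states. The matrices of a state occur in
  no other state's conditions, so they can be chosen state by state.\<close>
lemma feasible_P_iff_ex_feasible_SP:
  assumes "single_controller_game G"
  shows "feasible_P G v \<nu> \<longleftrightarrow> (\<exists>Z W. feasible_SP G v \<nu> Z W)"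
proof -
  define state_SP where "state_SP s Z W \<longleftrightarrow>
      symmetric_mat (deg1 G s div 2 + 1) Z \<and> symmetric_mat (deg1 G s div 2) W \<and> psd Z \<and> psd W \<and>
      hankel_adjoint (gram_mat (deg1 G s div 2) Z W) =
        E_mat G s *\<^sub>v v - discount G \<cdot>\<^sub>v (Q_mat G s *\<^sub>v v) - R_mat G s *\<^sub>v \<nu> s" for s Z W
  define moment_SP where "moment_SP s \<longleftrightarrow> \<nu> s \<in> carrier_vec (deg2 G s + 1) \<and> psd (hankel (\<nu> s)) \<and>
      psd (localizing (deg2 G s div 2) (hankel (\<nu> s))) \<and> \<nu> s $ 0 = 1" for s
  have poly_iff: "constraint_poly G v \<nu> s \<in> nonneg_polys \<longleftrightarrow> (\<exists>Z W. state_SP s Z W)"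
    if "s < num_states G" "v \<in> carrier_vec (num_states G)" "\<nu> s \<in> carrier_vec (deg2 G s + 1)" for s
  proof -
    have d: "2 * (deg1 G s div 2) = deg1 G s"
      using assms that(1) by (simp add: single_controller_game_def)
    have "degree (constraint_poly G v \<nu> s) \<le> 2 * (deg1 G s div 2)"
      unfolding d using assms that(1) by (intro degree_constraint_poly) (auto simp: single_controller_game_def)
    from nonneg_polys_iff_gram[OF this] show ?thesis
      unfolding d state_SP_def coeffs_constraint_poly[where \<nu> = \<nu>, OF that] .
  qed
  have moment_iff: "\<nu> s \<in> moment_space (deg2 G s) \<and> \<nu> s $ 0 = 1 \<longleftrightarrow> moment_SP s"
    if "s < num_states G" for s
  proof -
    have d: "2 * (deg2 G s div 2) = deg2 G s" "0 < deg2 G s div 2"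
      using assms that(1) by (auto simp: single_controller_game_def elim!: evenE)
    then show ?thesis
      using moment_space_iff_psd[of "\<nu> s" "deg2 G s div 2", unfolded d] moment_space_carrier
      by (auto simp: moment_SP_def)
  qed
  have SP: "feasible_SP G v \<nu> Z W \<longleftrightarrow> v \<in> carrier_vec (num_states G) \<and>
      (\<forall>s<num_states G. moment_SP s \<and> state_SP s (Z s) (W s))" for Z W
    unfolding feasible_SP_def state_SP_def moment_SP_def gram_mat_def localizing_def Let_def
    by (auto simp: scalar_prod_left_unit)
  have "feasible_P G v \<nu> \<longleftrightarrow> v \<in> carrier_vec (num_states G) \<and>
      (\<forall>s<num_states G. moment_SP s \<and> (\<exists>Z W. state_SP s Z W))"
    unfolding feasible_P_def using poly_iff moment_iff moment_SP_def by blast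
  also have "\<dots> \<longleftrightarrow> (\<exists>Z W. feasible_SP G v \<nu> Z W)"
    unfolding SP by metis
  finally show ?thesis .
qed

text \<open>Both problems have the same objective, which does not depend on the matrices, so optimal values and
  solutions agree once the feasible sets do.\<close>
theorem lemma6:
  fixes G :: polynomial_game
  assumes "single_controller_game G"
  shows "(\<forall>v \<nu>. feasible_P G v \<nu> \<longleftrightarrow> (\<exists>Z W. feasible_SP G v \<nu> Z W)) \<and>
         value_P G = value_SP G \<and>
         (\<forall>v \<nu>. optimal_P G v \<nu> \<longleftrightarrow> (\<exists>Z W. optimal_SP G v \<nu> Z W))"
proof -
  note iff = feasible_P_iff_ex_feasible_SP[OF assms]
  have "value_P G = value_SP G"
    unfolding value_P_def value_SP_def iff by (rule arg_cong[of _ _ Inf]) blast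
  moreover have "optimal_P G v \<nu> \<longleftrightarrow> (\<exists>Z W. optimal_SP G v \<nu> Z W)" for v \<nu>
    unfolding optimal_P_def optimal_SP_def iff by blast
  ultimately show ?thesis using iff by blast
qed

end
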